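(* Let $\mathcal{H}$ be a real Hilbert space, let $T\colon\mathcal{H}\to\mathcal{H}$ be nonexpansive with infimal displacement vector $v$, and assume $v\in\mathcal{R}(I-T)$. Let $x^0\in\mathcal{H}$, let $x_\star\in\mathcal{H}$ satisfy $x_\star-Tx_\star=v$, and consider the iterates of \[ x^{k+1}=\lambda_{k+1}x^k+(1-\lambda_{k+1})Tx^k,\qquad k=0,1,\dots, \] with $\lambda_k\in[0,1)$ for $k\in\mathbb{N}$. (1) The quantity $\frac{4}{\left(\sum_{i=1}^k(1-\lambda_i)\right)^2}\|x^0-x_\star\|^2$ (an upper bound on $\left\|\frac{x^k-x^0}{\sum_{i=1}^k(1-\lambda_i)}+v\right\|^2$) is, for every $k\ge1$, minimized over all choices of $\{\lambda_k\}_{k\in\mathbb{N}}\subset[0,1)$ at $\lambda_k=0$ for all $k\in\mathbb{N}$, and with this choice \[ \left\|\frac{x^k-x^0}{k}+v\right\|^2\le\frac{4}{k^2}\|x^0-x_\star\|^2,\qquad k=1,2,\dots. \] (2) The quantity $\frac{1}{\sum_{i=0}^k\lambda_{i+1}(1-\lambda_{i+1})}\|x^0-x_\star\|^2$ (an upper bound on $\left(\sum_{i=0}^k\frac{\lambda_{i+1}(1-\lambda_{i+1})}{\sum_{j=0}^k\lambda_{j+1}(1-\lambda_{j+1})}\|x^i-Tx^i-v\|\right)^2$ and on $(\|x^k-Tx^k\|-\|v\|)^2$ whenever the denominator is positive) is, for every $k\ge 1$, minimized over all choices of $\{\lambda_k\}_{k\in\mathbb{N}}\subset[0,1)$ for which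 the denominator is positive at $\lambda_k=\frac12$ for all $k\in\mathbb{N}$, and with this choice \[ \frac{1}{k+1}\sum_{i=0}^k\|x^i-Tx^i-v\|^2\le\frac{4}{k+1}\|x^0-x_\star\|^2 \quad\text{and}\quad (\|x^k-Tx^k\|-\|v\|)^2\le\frac{4}{k+1}\|x^0-x_\star\|^2,\qquad k=1,2,\dots. \]
   Context: $T\colon\mathcal{H}\to\mathcal{H}$ is nonexpansive if $\|Tx-Ty\|\le\|x-y\|$ for all $x,y\in\mathcal{H}$. $I$ is the identity operator and $\mathcal{R}(I-T)=\{x-Tx: x\in\mathcal{H}\}$. For nonexpansive $T$ the closure $\overline{\mathcal{R}(I-T)}$ is nonempty, closed and convex, and the infimal displacement vector of $T$ is its unique minimum-norm element $v=\Pi_{\overline{\mathcal{R}(I-T)}}(0)$. *)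

theory Defs
  imports "HOL-Analysis.Analysis"
begin

text \<open>
  The projection of \<open>0\<close> onto the closure of the range of \<open>I - T\<close>, as an element of minimal norm; for
  nonexpansive \<open>T\<close> it exists and is unique, as that closure is convex. The library's
  \<open>closest_point\<close> requires Heine-Borel and so does not cover infinite-dimensional Hilbert spaces.
\<close>
definition infimal_displacement_vector :: "('a::real_normed_vector \<Rightarrow> 'a) \<Rightarrow> 'a \<Rightarrow> bool" where
  "infimal_displacement_vector T v \<longleftrightarrow>
     is_arg_min norm (\<lambda>u. u \<in> closure (range (\<lambda>x. x - T x))) v"

primrec averaged_iter :: "('a::real_vector \<Rightarrow> 'a) \<Rightarrow> (nat \<Rightarrow> real) \<Rightarrow> 'a \<Rightarrow> nat \<Rightarrow> 'a" where
  "averaged_iter T lam x0 0 = x0"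
| "averaged_iter T lam x0 (Suc k) =
     lam (Suc k) *\<^sub>R averaged_iter T lam x0 k + (1 - lam (Suc k)) *\<^sub>R T (averaged_iter T lam x0 k)"

text \<open>The value \<open>lam 0\<close> is constrained but never used by the iteration.\<close>
definition relaxation_params :: "(nat \<Rightarrow> real) \<Rightarrow> bool" where
  "relaxation_params lam \<longleftrightarrow> (\<forall>k. 0 \<le> lam k \<and> lam k < 1)"

definition step_sum :: "(nat \<Rightarrow> real) \<Rightarrow> nat \<Rightarrow> real" where
  "step_sum lam k = (\<Sum>i=1..k. 1 - lam i)"

definition weight_sum :: "(nat \<Rightarrow> real) \<Rightarrow> nat \<Rightarrow> real" where
  "weight_sum lam k = (\<Sum>i=0..k. lam (i + 1) * (1 - lam (i + 1)))"

end

theory Submission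
  imports Defs
begin

text \<open>
  Write \<open>F x = x - T x\<close>. The key point is that the ray through \<open>xstar\<close> in direction \<open>-v\<close> consists of
  points at which \<open>F\<close> takes the value \<open>v\<close> (lemma \<open>ray_displacement\<close>). For \<open>a > 0\<close> the equation
  \<open>x + a *\<^sub>R F x = xstar\<close> has a solution, by Banach's fixed point theorem; monotonicity of \<open>F\<close> gives
  \<open>(norm (F x))\<^sup>2 \<le> F x \<bullet> v\<close>, so \<open>F x\<close> is no longer than \<open>v\<close> and, by minimality of \<open>norm v\<close>,
  equals \<open>v\<close>. Thus \<open>x = xstar - a *\<^sub>R v\<close>.

  Consequently the iteration started at \<open>xstar\<close> is explicit: after \<open>k\<close> steps it is at
  \<open>xstar - step_sum lam k *\<^sub>R v\<close>. Both parts compare an arbitrary orbit with this reference orbit.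
  The distance between the two does not increase, and the triangle inequality yields the first
  bound. More precisely, by the identity for the squared norm of a convex combination, the squared
  distance decreases in step \<open>i\<close> by at least
  \<open>lam (i + 1) * (1 - lam (i + 1)) * (norm (F x\<^sub>i - v))\<^sup>2\<close>. Summing these decrements gives the energy
  estimate \<open>weighted_residuals_bound\<close>, from which the second part follows by the Cauchy-Schwarz
  inequality for the average of \<open>norm (F x\<^sub>i - v)\<close>, and for the last iterate because
  \<open>norm (F x\<^sub>i)\<close> is nonincreasing in \<open>i\<close> and bounded below by \<open>norm v\<close>.

  The optimal parameters result from \<open>step_sum lam k \<le> k\<close> and \<open>t * (1 - t) \<le> 1 / 4\<close>.
\<close>

section \<open>The infimal displacement vector along a ray\<close>

lemma nonexpansive_norm_le:
  fixes T :: "'a::real_normed_vector \<Rightarrow> 'a"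
  assumes "1-lipschitz_on UNIV T"
  shows "norm (T x - T y) \<le> norm (x - y)"
  using lipschitz_onD[OF assms, of x y] by (simp add: dist_norm)

lemma displacement_monotone:
  fixes T :: "'a::real_inner \<Rightarrow> 'a"
  assumes "1-lipschitz_on UNIV T"
  shows "0 \<le> (x - y) \<bullet> ((x - T x) - (y - T y))"
proof -
  have "(x - y) \<bullet> (T x - T y) \<le> norm (x - y) * norm (T x - T y)"
    by (rule norm_cauchy_schwarz)
  also have "\<dots> \<le> norm (x - y) * norm (x - y)"
    by (intro mult_left_mono nonexpansive_norm_le assms norm_ge_zero)
  also have "\<dots> = (x - y) \<bullet> (x - y)"
    by (simp add: dot_square_norm power2_eq_square)
  finally show ?thesis
    by (simp add: algebra_simps)
qed

lemma infimal_displacement_le: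
  assumes "infimal_displacement_vector T v"
  shows "norm v \<le> norm (x - T x)"
proof -
  have "x - T x \<in> closure (range (\<lambda>x. x - T x))"
    by (rule subsetD[OF closure_subset]) (rule range_eqI[of _ _ x], rule refl)
  moreover have "\<not> norm u < norm v" if "u \<in> closure (range (\<lambda>x. x - T x))" for u
    using assms that unfolding infimal_displacement_vector_def is_arg_min_def by blast
  ultimately show ?thesis
    by (simp add: not_less)
qed

text \<open>
  The solution \<open>x\<close> is the value at \<open>z\<close> of the resolvent of \<open>a *\<^sub>R (I - T)\<close>, i.e. the fixed point of
  the contraction \<open>x \<mapsto> (z + a *\<^sub>R T x) / (1 + a)\<close>.
\<close>
lemma resolvent_exists:
  fixes T :: "'a::{real_normed_vector,complete_space} \<Rightarrow> 'a"
  assumes T: "1-lipschitz_on UNIV T" and a: "0 < a"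
  shows "\<exists>x. x + a *\<^sub>R (x - T x) = z"
proof -
  define G where "G x = (z + a *\<^sub>R T x) /\<^sub>R (1 + a)" for x
  have "dist (G x) (G y) \<le> a / (1 + a) * dist x y" for x y
  proof -
    have "G x - G y = (a / (1 + a)) *\<^sub>R (T x - T y)"
      by (simp add: G_def divide_inverse scaleR_diff_right scaleR_add_right mult.commute)
    then have "dist (G x) (G y) = a / (1 + a) * norm (T x - T y)"
      using a by (simp add: dist_norm)
    also have "\<dots> \<le> a / (1 + a) * norm (x - y)"
      using a by (intro mult_left_mono nonexpansive_norm_le[OF T]) simp
    finally show ?thesis
      by (simp add: dist_norm)
  qed
  then have "\<exists>!x. G x = x"
    using a by (intro banach_fix_type[where c = "a / (1 + a)"]) auto
  then obtain x where "G x = x"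
    by blast
  then have "(1 + a) *\<^sub>R x = (1 + a) *\<^sub>R G x"
    by simp
  also have "\<dots> = z + a *\<^sub>R T x"
    using a by (simp add: G_def)
  finally have "x + a *\<^sub>R (x - T x) = z"
    by (simp add: algebra_simps)
  then show ?thesis ..
qed

text \<open>
  For \<open>a > 0\<close> the resolvent point \<open>x\<close> of \<open>xstar\<close> satisfies \<open>x - xstar = - a *\<^sub>R w\<close> with
  \<open>w = x - T x\<close>, so monotonicity between \<open>x\<close> and \<open>xstar\<close> reads \<open>w \<bullet> w \<le> w \<bullet> v\<close>. Among vectors that
  are at least as long as \<open>v\<close>, only \<open>w = v\<close> satisfies this.
\<close>
lemma ray_displacement:
  fixes T :: "'a::{real_inner,complete_space} \<Rightarrow> 'a"
  assumes T: "1-lipschitz_on UNIV T" and v: "infimal_displacement_vector T v"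
    and xstar: "xstar - T xstar = v" and a: "0 \<le> a"
  shows "T (xstar - a *\<^sub>R v) = xstar - a *\<^sub>R v - v"
proof (cases "a = 0")
  case True
  then show ?thesis
    using xstar by (simp add: algebra_simps)
next
  case False
  with a have a: "0 < a"
    by simp
  obtain x where x: "x + a *\<^sub>R (x - T x) = xstar"
    using resolvent_exists[OF T a] by blast
  define w where "w = x - T x"
  have "x - xstar = - a *\<^sub>R w"
    using x by (simp add: w_def algebra_simps)
  then have "0 \<le> (- a *\<^sub>R w) \<bullet> (w - v)"
    using displacement_monotone[OF T, of x xstar] by (simp add: xstar w_def)
  then have ww: "w \<bullet> w \<le> w \<bullet> v"
    using a by (simp add: inner_diff_right mult_le_cancel_left)
  have "norm v \<le> norm w"
    unfolding w_def by (rule infimal_displacement_le[OF v])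
  then have "v \<bullet> v \<le> w \<bullet> w"
    by (simp add: dot_square_norm power_mono)
  with ww have "(w - v) \<bullet> (w - v) \<le> 0"
    by (simp add: inner_diff_left inner_diff_right inner_commute)
  then have "w = v"
    using inner_ge_zero[of "w - v"] by auto
  moreover from this have "x = xstar - a *\<^sub>R v"
    using x by (simp add: eq_diff_eq flip: w_def)
  ultimately show ?thesis
    by (auto simp: w_def algebra_simps)
qed

section \<open>Comparison with the reference orbit\<close>

lemma step_sum_Suc [simp]: "step_sum lam (Suc k) = step_sum lam k + (1 - lam (Suc k))"
  by (simp add: step_sum_def)

lemma step_sum_0 [simp]: "step_sum lam 0 = 0"
  by (simp add: step_sum_def)

lemma step_sum_nonneg: "relaxation_params lam \<Longrightarrow> 0 \<le> step_sum lam k"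
  by (auto simp: step_sum_def relaxation_params_def less_imp_le intro!: sum_nonneg)

lemma step_sum_pos: "relaxation_params lam \<Longrightarrow> 1 \<le> k \<Longrightarrow> 0 < step_sum lam k"
  by (auto simp: step_sum_def relaxation_params_def intro!: sum_pos)

lemma averaged_iter_ray:
  fixes T :: "'a::{real_inner,complete_space} \<Rightarrow> 'a"
  assumes "1-lipschitz_on UNIV T" "infimal_displacement_vector T v" "xstar - T xstar = v"
    and lam: "relaxation_params lam"
  shows "averaged_iter T lam xstar k = xstar - step_sum lam k *\<^sub>R v"
proof (induction k)
  case (Suc k)
  have "T (xstar - step_sum lam k *\<^sub>R v) = xstar - step_sum lam k *\<^sub>R v - v"
    by (intro ray_displacement assms step_sum_nonneg)
  then have "averaged_iter T lam xstar (Suc k) = lam (Suc k) *\<^sub>R (xstar - step_sum lam k *\<^sub>R v)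
      + (1 - lam (Suc k)) *\<^sub>R (xstar - step_sum lam k *\<^sub>R v - v)"
    by (simp add: Suc)
  then show ?case
    by (simp add: algebra_simps)
qed simp

lemma norm_convex_combination_squared:
  fixes d e :: "'a::real_inner"
  shows "(norm (t *\<^sub>R d + (1 - t) *\<^sub>R e))\<^sup>2
    = t * (norm d)\<^sup>2 + (1 - t) * (norm e)\<^sup>2 - t * (1 - t) * (norm (d - e))\<^sup>2"
  unfolding power2_norm_eq_inner inner_add_left inner_add_right inner_diff_left inner_diff_right
    inner_scaleR_left inner_scaleR_right inner_commute[of e d]
  by algebra

text \<open>
  With \<open>d\<close> the difference of the two current points and \<open>e\<close> that of their images, the next difference
  is \<open>t *\<^sub>R d + (1 - t) *\<^sub>R e\<close> where \<open>t = lam (Suc k)\<close>. Since \<open>norm e \<le> norm d\<close>, the only other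
  contribution to its squared norm is the strict convexity term \<open>- t * (1 - t) * (norm (d - e))\<^sup>2\<close>, and
  \<open>d - e\<close> is the difference of the displacements.
\<close>
lemma averaged_iter_step_decrease:
  fixes T :: "'a::real_inner \<Rightarrow> 'a" and x0 y0 :: 'a
  assumes T: "1-lipschitz_on UNIV T" and lam: "relaxation_params lam"
  defines "x \<equiv> averaged_iter T lam x0" and "y \<equiv> averaged_iter T lam y0"
  shows "(norm (x (Suc k) - y (Suc k)))\<^sup>2
      + lam (Suc k) * (1 - lam (Suc k)) * (norm ((x k - T (x k)) - (y k - T (y k))))\<^sup>2
    \<le> (norm (x k - y k))\<^sup>2"
proof -
  let ?t = "lam (Suc k)" and ?d = "x k - y k" and ?e = "T (x k) - T (y k)"
  have "x (Suc k) - y (Suc k) = ?t *\<^sub>R ?d + (1 - ?t) *\<^sub>R ?e"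
    by (simp add: x_def y_def algebra_simps)
  then have "(norm (x (Suc k) - y (Suc k)))\<^sup>2 + ?t * (1 - ?t) * (norm (?d - ?e))\<^sup>2
    = ?t * (norm ?d)\<^sup>2 + (1 - ?t) * (norm ?e)\<^sup>2"
    by (simp only: norm_convex_combination_squared diff_add_cancel)
  moreover have "(x k - T (x k)) - (y k - T (y k)) = ?d - ?e"
    by simp
  ultimately have "(norm (x (Suc k) - y (Suc k)))\<^sup>2
      + ?t * (1 - ?t) * (norm ((x k - T (x k)) - (y k - T (y k))))\<^sup>2
    = ?t * (norm ?d)\<^sup>2 + (1 - ?t) * (norm ?e)\<^sup>2"
    by metis
  also have "\<dots> \<le> ?t * (norm ?d)\<^sup>2 + (1 - ?t) * (norm ?d)\<^sup>2"
    using lam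
    by (intro add_left_mono mult_left_mono power_mono nonexpansive_norm_le T)
       (auto simp: relaxation_params_def less_imp_le)
  finally show ?thesis
    by (simp add: algebra_simps)
qed

lemma averaged_iter_sum_decrease:
  fixes T :: "'a::real_inner \<Rightarrow> 'a" and x0 y0 :: 'a
  assumes T: "1-lipschitz_on UNIV T" and lam: "relaxation_params lam"
  defines "x \<equiv> averaged_iter T lam x0" and "y \<equiv> averaged_iter T lam y0"
  shows "(norm (x k - y k))\<^sup>2 + (\<Sum>i<k. lam (Suc i) * (1 - lam (Suc i))
        * (norm ((x i - T (x i)) - (y i - T (y i))))\<^sup>2)
    \<le> (norm (x0 - y0))\<^sup>2"
proof (induction k)
  case (Suc k)
  then show ?case
    using averaged_iter_step_decrease[OF T lam, of x0 k y0] by (simp add: x_def y_def)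
qed (simp add: x_def y_def)

lemma relaxation_product_nonneg: "relaxation_params lam \<Longrightarrow> 0 \<le> lam i * (1 - lam i)"
  by (simp add: relaxation_params_def less_imp_le)

lemma averaged_iter_dist_le:
  fixes T :: "'a::real_inner \<Rightarrow> 'a"
  assumes T: "1-lipschitz_on UNIV T" and lam: "relaxation_params lam"
  shows "norm (averaged_iter T lam x0 k - averaged_iter T lam y0 k) \<le> norm (x0 - y0)"
proof -
  have "0 \<le> (\<Sum>i<k. lam (Suc i) * (1 - lam (Suc i)) * (norm ((averaged_iter T lam x0 i
      - T (averaged_iter T lam x0 i)) - (averaged_iter T lam y0 i
      - T (averaged_iter T lam y0 i))))\<^sup>2)"
    by (intro sum_nonneg mult_nonneg_nonneg[OF relaxation_product_nonneg[OF lam]]) simp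
  then have "(norm (averaged_iter T lam x0 k - averaged_iter T lam y0 k))\<^sup>2 \<le> (norm (x0 - y0))\<^sup>2"
    using averaged_iter_sum_decrease[OF T lam, of x0 k y0] by linarith
  then show ?thesis
    by (simp add: power2_le_iff_abs_le)
qed

text \<open>
  The error of the normalized iterate is the difference of the initial and the current offset from
  the reference orbit, each of norm at most \<open>norm (x0 - xstar)\<close>; hence the factor \<open>4 = 2\<^sup>2\<close>.
\<close>
lemma normalized_iterate_bound:
  fixes T :: "'a::{real_inner,complete_space} \<Rightarrow> 'a"
  assumes T: "1-lipschitz_on UNIV T" and v: "infimal_displacement_vector T v"
    and xstar: "xstar - T xstar = v" and lam: "relaxation_params lam" and k: "1 \<le> k"
  shows "(norm ((averaged_iter T lam x0 k - x0) /\<^sub>R step_sum lam k + v))\<^sup>2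
    \<le> 4 / (step_sum lam k)\<^sup>2 * (norm (x0 - xstar))\<^sup>2"
proof -
  let ?x = "averaged_iter T lam x0 k" and ?y = "averaged_iter T lam xstar k"
    and ?s = "step_sum lam k"
  have s: "0 < ?s"
    by (rule step_sum_pos[OF lam k])
  have "(?x - x0) /\<^sub>R ?s + v = ((?x - ?y) - (x0 - xstar)) /\<^sub>R ?s"
    using s by (simp add: averaged_iter_ray[OF T v xstar lam] algebra_simps)
  then have "norm ((?x - x0) /\<^sub>R ?s + v) = norm ((?x - ?y) - (x0 - xstar)) / ?s"
    using s by (simp add: divide_inverse_commute)
  also have "\<dots> \<le> 2 * norm (x0 - xstar) / ?s"
    using s norm_triangle_ineq4[of "?x - ?y" "x0 - xstar"]
      averaged_iter_dist_le[OF T lam, of x0 k xstar]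
    by (intro divide_right_mono) auto
  finally have "(norm ((?x - x0) /\<^sub>R ?s + v))\<^sup>2 \<le> (2 * norm (x0 - xstar) / ?s)\<^sup>2"
    by (intro power_mono) auto
  then show ?thesis
    by (simp add: power_divide power_mult_distrib)
qed

section \<open>Residuals\<close>

text \<open>
  The displacement along the reference orbit is always \<open>v\<close>, so the decrements accumulated in
  \<open>averaged_iter_sum_decrease\<close> become the residuals \<open>x i - T (x i) - v\<close>.
\<close>
lemma weighted_residuals_bound:
  fixes T :: "'a::{real_inner,complete_space} \<Rightarrow> 'a" and x0 :: 'a
  assumes T: "1-lipschitz_on UNIV T" and v: "infimal_displacement_vector T v"
    and xstar: "xstar - T xstar = v" and lam: "relaxation_params lam"
  defines "x \<equiv> averaged_iter T lam x0"
  shows "(\<Sum>i=0..k. lam (i + 1) * (1 - lam (i + 1)) * (norm (x i - T (x i) - v))\<^sup>2)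
    \<le> (norm (x0 - xstar))\<^sup>2"
proof -
  let ?y = "averaged_iter T lam xstar"
  have ray: "?y i - T (?y i) = v" for i
    by (simp add: averaged_iter_ray[OF T v xstar lam]
        ray_displacement[OF T v xstar step_sum_nonneg[OF lam]])
  have "(norm (x (Suc k) - ?y (Suc k)))\<^sup>2
      + (\<Sum>i<Suc k. lam (Suc i) * (1 - lam (Suc i)) * (norm (x i - T (x i) - v))\<^sup>2)
    \<le> (norm (x0 - xstar))\<^sup>2"
    using averaged_iter_sum_decrease[OF T lam, of x0 "Suc k" xstar]
    unfolding ray x_def[symmetric] .
  moreover have "{0..k} = {..<Suc k}"
    by auto
  ultimately show ?thesis
    using zero_le_power2[of "norm (x (Suc k) - ?y (Suc k))"] by (simp only: Suc_eq_plus1)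
qed

text \<open>
  Moving by \<open>(1 - lam (Suc k)) *\<^sub>R (T x - x)\<close> shifts \<open>T x\<close> by at most \<open>1 - lam (Suc k)\<close> times the old
  displacement, and \<open>lam (Suc k)\<close> times that displacement is left over from the averaging.
\<close>
lemma displacement_norm_step:
  fixes T :: "'a::real_normed_vector \<Rightarrow> 'a" and x0 :: 'a
  assumes T: "1-lipschitz_on UNIV T" and lam: "relaxation_params lam"
  defines "x \<equiv> averaged_iter T lam x0"
  shows "norm (x (Suc k) - T (x (Suc k))) \<le> norm (x k - T (x k))"
proof -
  let ?t = "lam (Suc k)"
  have t: "0 \<le> ?t" "?t < 1"
    using lam by (auto simp: relaxation_params_def)
  have move: "x k - x (Suc k) = (1 - ?t) *\<^sub>R (x k - T (x k))"
    by (simp add: x_def algebra_simps)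
  have "x (Suc k) - T (x (Suc k)) = ?t *\<^sub>R (x k - T (x k)) + (T (x k) - T (x (Suc k)))"
    by (simp add: x_def algebra_simps)
  then have "norm (x (Suc k) - T (x (Suc k)))
      \<le> norm (?t *\<^sub>R (x k - T (x k))) + norm (T (x k) - T (x (Suc k)))"
    by (metis norm_triangle_ineq)
  also have "\<dots> \<le> norm (?t *\<^sub>R (x k - T (x k))) + norm (x k - x (Suc k))"
    by (intro add_left_mono nonexpansive_norm_le T)
  also have "\<dots> = ?t * norm (x k - T (x k)) + (1 - ?t) * norm (x k - T (x k))"
    using t by (simp add: move)
  also have "\<dots> = norm (x k - T (x k))"
    by (simp add: algebra_simps)
  finally show ?thesis .
qed

lemma displacement_norm_antimono:
  fixes T :: "'a::real_normed_vector \<Rightarrow> 'a" and x0 :: 'a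
  assumes T: "1-lipschitz_on UNIV T" and lam: "relaxation_params lam" and "i \<le> k"
  defines "x \<equiv> averaged_iter T lam x0"
  shows "norm (x k - T (x k)) \<le> norm (x i - T (x i))"
  using lift_Suc_antimono_le[of "\<lambda>k. norm (x k - T (x k))", OF _ \<open>i \<le> k\<close>]
    displacement_norm_step[OF T lam, of x0]
  unfolding x_def by blast

text \<open>
  For every \<open>i \<le> k\<close>, the excess \<open>norm (F x\<^sub>k) - norm v \<ge> 0\<close> is at most
  \<open>norm (F x\<^sub>i) - norm v \<le> norm (F x\<^sub>i - v)\<close>. The detour through the norms is what makes the
  residuals comparable, since monotonicity is available for \<open>norm (F x\<^sub>i)\<close>.
\<close>
lemma displacement_excess_le_residual:
  fixes T :: "'a::real_normed_vector \<Rightarrow> 'a" and x0 :: 'a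
  assumes T: "1-lipschitz_on UNIV T" and v: "infimal_displacement_vector T v"
    and lam: "relaxation_params lam" and i: "i \<le> k"
  defines "x \<equiv> averaged_iter T lam x0"
  shows "(norm (x k - T (x k)) - norm v)\<^sup>2 \<le> (norm (x i - T (x i) - v))\<^sup>2"
proof (rule power_mono)
  show "norm (x k - T (x k)) - norm v \<le> norm (x i - T (x i) - v)"
    using displacement_norm_antimono[OF T lam i, of x0] norm_triangle_ineq2[of "x i - T (x i)" v]
    unfolding x_def by linarith
  show "0 \<le> norm (x k - T (x k)) - norm v"
    using infimal_displacement_le[OF v] by simp
qed

lemma last_displacement_bound:
  fixes T :: "'a::{real_inner,complete_space} \<Rightarrow> 'a" and x0 :: 'a
  assumes T: "1-lipschitz_on UNIV T" and v: "infimal_displacement_vector T v"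
    and xstar: "xstar - T xstar = v" and lam: "relaxation_params lam"
    and pos: "0 < weight_sum lam k"
  defines "x \<equiv> averaged_iter T lam x0"
  shows "(norm (x k - T (x k)) - norm v)\<^sup>2 \<le> 1 / weight_sum lam k * (norm (x0 - xstar))\<^sup>2"
proof -
  have "weight_sum lam k * (norm (x k - T (x k)) - norm v)\<^sup>2
    = (\<Sum>i=0..k. lam (i + 1) * (1 - lam (i + 1)) * (norm (x k - T (x k)) - norm v)\<^sup>2)"
    by (simp add: weight_sum_def sum_distrib_right)
  also have "\<dots> \<le> (\<Sum>i=0..k. lam (i + 1) * (1 - lam (i + 1)) * (norm (x i - T (x i) - v))\<^sup>2)"
    unfolding x_def
    by (intro sum_mono mult_left_mono displacement_excess_le_residual[OF T v lam]
        relaxation_product_nonneg[OF lam]) auto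
  also have "\<dots> \<le> (norm (x0 - xstar))\<^sup>2"
    unfolding x_def by (rule weighted_residuals_bound[OF T v xstar lam])
  finally show ?thesis
    using pos by (simp add: field_simps)
qed

text \<open>Cauchy-Schwarz for the vectors with entries \<open>sqrt (w i)\<close> and \<open>sqrt (w i) * r i\<close>.\<close>
lemma weighted_sum_squared_le:
  fixes w r :: "'i \<Rightarrow> real"
  assumes w: "\<And>i. i \<in> A \<Longrightarrow> 0 \<le> w i"
  shows "(\<Sum>i\<in>A. w i * r i)\<^sup>2 \<le> (\<Sum>i\<in>A. w i) * (\<Sum>i\<in>A. w i * (r i)\<^sup>2)"
proof -
  have "(\<Sum>i\<in>A. sqrt (w i) * (sqrt (w i) * r i))\<^sup>2
      \<le> (\<Sum>i\<in>A. (sqrt (w i))\<^sup>2) * (\<Sum>i\<in>A. (sqrt (w i) * r i)\<^sup>2)"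
    by (rule Cauchy_Schwarz_ineq_sum)
  moreover have "(\<Sum>i\<in>A. sqrt (w i) * (sqrt (w i) * r i)) = (\<Sum>i\<in>A. w i * r i)"
    using w by (intro sum.cong) (simp_all flip: mult.assoc)
  ultimately show ?thesis
    using w by (simp add: power_mult_distrib)
qed

lemma averaged_residual_bound:
  fixes T :: "'a::{real_inner,complete_space} \<Rightarrow> 'a" and x0 :: 'a
  assumes T: "1-lipschitz_on UNIV T" and v: "infimal_displacement_vector T v"
    and xstar: "xstar - T xstar = v" and lam: "relaxation_params lam"
    and pos: "0 < weight_sum lam k"
  defines "x \<equiv> averaged_iter T lam x0"
  shows "(\<Sum>i=0..k. lam (i + 1) * (1 - lam (i + 1)) / weight_sum lam k
      * norm (x i - T (x i) - v))\<^sup>2 \<le> 1 / weight_sum lam k * (norm (x0 - xstar))\<^sup>2"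
proof -
  let ?W = "weight_sum lam k" and ?w = "\<lambda>i. lam (i + 1) * (1 - lam (i + 1))"
    and ?r = "\<lambda>i. norm (x i - T (x i) - v)"
  have "(\<Sum>i=0..k. ?w i * ?r i)\<^sup>2 \<le> ?W * (\<Sum>i=0..k. ?w i * (?r i)\<^sup>2)"
    unfolding weight_sum_def
    by (rule weighted_sum_squared_le) (rule relaxation_product_nonneg[OF lam])
  also have "\<dots> \<le> ?W * (norm (x0 - xstar))\<^sup>2"
    using pos unfolding x_def
    by (intro mult_left_mono weighted_residuals_bound[OF T v xstar lam]) simp
  finally have "(\<Sum>i=0..k. ?w i * ?r i)\<^sup>2 / ?W\<^sup>2 \<le> ?W * (norm (x0 - xstar))\<^sup>2 / ?W\<^sup>2"
    by (rule divide_right_mono) simp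
  moreover have "(\<Sum>i=0..k. ?w i / ?W * ?r i) = (\<Sum>i=0..k. ?w i * ?r i) / ?W"
    by (simp add: sum_divide_distrib)
  ultimately show ?thesis
    using pos by (simp add: power_divide power2_eq_square)
qed

section \<open>Optimal relaxation parameters\<close>

lemma step_sum_le: "relaxation_params lam \<Longrightarrow> step_sum lam k \<le> real k"
  by (induction k) (simp_all add: relaxation_params_def add_increasing2 diff_le_eq)

lemma step_sum_zero [simp]: "step_sum (\<lambda>_. 0) k = real k"
  by (simp add: step_sum_def)

lemma weight_sum_le: "weight_sum lam k \<le> (real k + 1) / 4"
proof -
  have "t * (1 - t) \<le> 1 / 4" for t :: real
    using zero_le_power2[of "t - 1 / 2"] by (simp add: power2_eq_square algebra_simps)
  then have "weight_sum lam k \<le> (\<Sum>i=0..k. 1 / 4)"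
    unfolding weight_sum_def by (rule sum_mono)
  then show ?thesis
    by (simp add: algebra_simps)
qed

lemma weight_sum_half [simp]: "weight_sum (\<lambda>_. 1 / 2) k = (real k + 1) / 4"
  by (simp add: weight_sum_def algebra_simps)

lemma zero_minimizes_step_bound:
  assumes "1 \<le> k" "0 \<le> c"
  shows "is_arg_min (\<lambda>lam. 4 / (step_sum lam k)\<^sup>2 * c) relaxation_params (\<lambda>_. 0)"
proof -
  have "4 / (real k)\<^sup>2 * c \<le> 4 / (step_sum lam k)\<^sup>2 * c" if "relaxation_params lam" for lam
    using step_sum_pos[OF that \<open>1 \<le> k\<close>] step_sum_le[OF that, of k] \<open>0 \<le> c\<close>
    by (intro mult_right_mono divide_left_mono power_mono) auto
  moreover have "relaxation_params (\<lambda>_. 0)"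
    by (simp add: relaxation_params_def)
  ultimately show ?thesis
    by (auto simp: is_arg_min_def not_less)
qed

lemma half_minimizes_weight_bound:
  assumes "0 \<le> c"
  shows "is_arg_min (\<lambda>lam. 1 / weight_sum lam k * c)
    (\<lambda>lam. relaxation_params lam \<and> 0 < weight_sum lam k) (\<lambda>_. 1 / 2)"
proof -
  have "1 / ((real k + 1) / 4) * c \<le> 1 / weight_sum lam k * c" if "0 < weight_sum lam k" for lam
    using that weight_sum_le[of lam k] \<open>0 \<le> c\<close>
    by (intro mult_right_mono divide_left_mono) auto
  moreover have "relaxation_params (\<lambda>_. 1 / 2)" "0 < (real k + 1) / 4"
    by (simp_all add: relaxation_params_def)
  ultimately show ?thesis
    unfolding is_arg_min_def weight_sum_half by (blast dest: leD)
qed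

section \<open>The convergence bounds\<close>

theorem corollary5:
  fixes T :: "'a::{real_inner,complete_space} \<Rightarrow> 'a"
    and v x0 xstar :: 'a
  assumes nonexpansive: "1-lipschitz_on UNIV T"
    and displacement: "infimal_displacement_vector T v"
    and attained: "v \<in> range (\<lambda>x. x - T x)"
    and xstar: "xstar - T xstar = v"
  shows
    "(\<forall>k\<ge>1.
        (\<forall>lam. relaxation_params lam \<longrightarrow>
           (norm ((averaged_iter T lam x0 k - x0) /\<^sub>R step_sum lam k + v))\<^sup>2
             \<le> 4 / (step_sum lam k)\<^sup>2 * (norm (x0 - xstar))\<^sup>2)
        \<and> is_arg_min (\<lambda>lam. 4 / (step_sum lam k)\<^sup>2 * (norm (x0 - xstar))\<^sup>2)
            relaxation_params (\<lambda>_. 0)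
        \<and> (norm ((averaged_iter T (\<lambda>_. 0) x0 k - x0) /\<^sub>R real k + v))\<^sup>2
            \<le> 4 / (real k)\<^sup>2 * (norm (x0 - xstar))\<^sup>2)
     \<and>
     (\<forall>k\<ge>1.
        (\<forall>lam. relaxation_params lam \<and> 0 < weight_sum lam k \<longrightarrow>
           (\<Sum>i=0..k. lam (i + 1) * (1 - lam (i + 1)) / weight_sum lam k
               * norm (averaged_iter T lam x0 i - T (averaged_iter T lam x0 i) - v))\<^sup>2
             \<le> 1 / weight_sum lam k * (norm (x0 - xstar))\<^sup>2
           \<and> (norm (averaged_iter T lam x0 k - T (averaged_iter T lam x0 k)) - norm v)\<^sup>2
             \<le> 1 / weight_sum lam k * (norm (x0 - xstar))\<^sup>2)
        \<and> is_arg_min (\<lambda>lam. 1 / weight_sum lam k * (norm (x0 - xstar))\<^sup>2)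
            (\<lambda>lam. relaxation_params lam \<and> 0 < weight_sum lam k) (\<lambda>_. 1 / 2)
        \<and> 1 / (real k + 1) * (\<Sum>i=0..k. (norm (averaged_iter T (\<lambda>_. 1 / 2) x0 i
               - T (averaged_iter T (\<lambda>_. 1 / 2) x0 i) - v))\<^sup>2)
            \<le> 4 / (real k + 1) * (norm (x0 - xstar))\<^sup>2
        \<and> (norm (averaged_iter T (\<lambda>_. 1 / 2) x0 k - T (averaged_iter T (\<lambda>_. 1 / 2) x0 k)) - norm v)\<^sup>2
            \<le> 4 / (real k + 1) * (norm (x0 - xstar))\<^sup>2)"
proof -
  let ?D = "(norm (x0 - xstar))\<^sup>2"
  note hyps = nonexpansive displacement xstar
  have zero: "relaxation_params (\<lambda>_. 0)" and half: "relaxation_params (\<lambda>_. 1 / 2)"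
    by (simp_all add: relaxation_params_def)
  have half_average: "1 / (real k + 1) * (\<Sum>i=0..k. (norm (averaged_iter T (\<lambda>_. 1 / 2) x0 i
      - T (averaged_iter T (\<lambda>_. 1 / 2) x0 i) - v))\<^sup>2) \<le> 4 / (real k + 1) * ?D" for k
  proof -
    have "(\<Sum>i=0..k. (norm (averaged_iter T (\<lambda>_. 1 / 2) x0 i
        - T (averaged_iter T (\<lambda>_. 1 / 2) x0 i) - v))\<^sup>2) \<le> 4 * ?D"
      using weighted_residuals_bound[OF hyps half, of x0 k]
      by (simp flip: sum_divide_distrib)
    from divide_right_mono[OF this, of "real k + 1"] show ?thesis
      by simp
  qed
  have half_last: "(norm (averaged_iter T (\<lambda>_. 1 / 2) x0 k
      - T (averaged_iter T (\<lambda>_. 1 / 2) x0 k)) - norm v)\<^sup>2 \<le> 4 / (real k + 1) * ?D" for k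
    using last_displacement_bound[OF hyps half, of k x0] by simp
  show ?thesis
  proof (intro conjI allI impI; (elim conjE)?)
    fix k :: nat
    assume k: "1 \<le> k"
    show "is_arg_min (\<lambda>lam. 4 / (step_sum lam k)\<^sup>2 * ?D) relaxation_params (\<lambda>_. 0)"
      by (rule zero_minimizes_step_bound[OF k zero_le_power2])
    show "(norm ((averaged_iter T (\<lambda>_. 0) x0 k - x0) /\<^sub>R real k + v))\<^sup>2 \<le> 4 / (real k)\<^sup>2 * ?D"
      using normalized_iterate_bound[OF hyps zero k, of x0] unfolding step_sum_zero .
  qed (rule normalized_iterate_bound[OF hyps] averaged_residual_bound[OF hyps]
      last_displacement_bound[OF hyps] half_minimizes_weight_bound[OF zero_le_power2]
      half_average half_last; assumption)+
qed

end
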